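(* Let $C, \theta > 0$ be real numbers. There is a constant $K>0$, depending at most on $C$ and $\theta$, such that the following holds. Let $x \ge 1$ and $Q \ge 1$ be real numbers, let $f$ be an integer-valued arithmetic function satisfying $1 \leq f(n) \leq C x^{\theta}$ for all positive integers $n \leq x$, and let $(a_n)_{n \geq 1}$ be a sequence of complex numbers. Then $$ \sum_{q \leq Q}\ \sum_{c , d\in \mathbb{F}_q^{*}} \left| \sum_{n \leq x} a_n\, e\left(\frac{nd + f(n)c}{q}\right) \right|^2 \ \leq\ K\, (Q+x^\theta)(Q^2+x) \sum_{n \leq x} |a_n|^2. $$
   Context: Notation: $e(t) = e^{2\pi i t}$. The sum $\sum_{q\le Q}$ runs over odd primes $q \le Q$; $\mathbb{F}_q^{*}$ is identified with the residues $\{1,\dots,q-1\}$ modulo $q$. The sum over $n\le x$ is over positive integers. *)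

theory Defs
  imports "HOL-Analysis.Analysis" "HOL-Computational_Algebra.Primes"
begin

definition e :: "real \<Rightarrow> complex" where
  "e t = exp (2 * of_real pi * \<i> * of_real t)"

end

theory Submission
  imports Defs
begin

text \<open>
  For fixed \<open>q\<close> and \<open>d\<close>, the integers up to \<open>M = C x\<^sup>\<theta>\<close> split into at most \<open>M/q + 1\<close> blocks
  of \<open>q\<close> consecutive values. Cauchy-Schwarz over the blocks and Parseval modulo \<open>q\<close> inside each
  block bound the sum over \<open>c\<close> by \<open>(q + M) \<Sum>\<^sub>v \<bar>\<Sum>\<^bsub>f n = v\<^esub> a\<^sub>n e(nd/q)\<bar>\<^sup>2\<close>. For each \<open>v\<close> the
  one-dimensional large sieve then bounds the sum over \<open>d\<close> and \<open>q\<close> by a multiple of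
  \<open>(Q\<^sup>2 + x) \<Sum>\<^bsub>f n = v\<^esub> \<bar>a\<^sub>n\<bar>\<^sup>2\<close>.

  The large sieve itself is proved by finite sums only. All fractions \<open>d/q\<close> lie in the grid
  \<open>(1/L)\<int>\<close> for a suitable \<open>L\<close>. The value of a trigonometric polynomial at a grid point is the
  sum over a short window starting there of another polynomial with comparable
  coefficients; the windows are disjoint, and Parseval modulo \<open>L\<close> applies.
\<close>

section \<open>Additive characters and Parseval modulo \<open>L\<close>\<close>

lemma e_eq_cis: "e t = cis (2 * pi * t)"
  by (simp add: e_def cis_conv_exp mult_ac)

lemma cmod_e [simp]: "cmod (e t) = 1"
  by (simp add: e_eq_cis)

lemma e_add: "e (s + t) = e s * e t"
  by (simp add: e_eq_cis cis_mult algebra_simps)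

lemma e_of_nat_mult: "e (real n * t) = e t ^ n"
  by (simp add: e_eq_cis Complex.DeMoivre algebra_simps)

lemma e_eq_1_iff: "e t = 1 \<longleftrightarrow> t \<in> \<int>"
proof
  assume "e t = 1"
  then obtain n :: int where "2 * pi * t = of_int n * (2 * pi)"
    by (auto simp: e_eq_cis complex_eq_iff cos_one_2pi_int mult_ac)
  then have "t = of_int n"
    by simp
  then show "t \<in> \<int>"
    by simp
qed (auto simp: e_eq_cis cis_multiple_2pi)

lemma cnj_e: "cnj (e t) = e (- t)"
  by (simp add: e_eq_cis cis_cnj)

text \<open>The summand is \<open>z ^ k\<close> for an \<open>L\<close>-th root of unity
  \<open>z\<close>, so the geometric sum vanishes unless \<open>z = 1\<close>, which happens exactly
  when \<open>v\<close> and \<open>w\<close> are congruent modulo \<open>L\<close>.\<close>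

lemma e_orthogonality:
  fixes L v w :: nat
  assumes "L > 0"
  shows "(\<Sum>k<L. e (real v * real k / real L) * cnj (e (real w * real k / real L))) =
    (if v mod L = w mod L then of_nat L else 0)"
proof -
  define z where "z = e ((real v - real w) / real L)"
  have "(\<Sum>k<L. e (real v * real k / real L) * cnj (e (real w * real k / real L))) = (\<Sum>k<L. z ^ k)"
    by (rule sum.cong)
      (simp_all add: cnj_e z_def algebra_simps diff_divide_distrib flip: e_add e_of_nat_mult)
  moreover have "z = 1 \<longleftrightarrow> v mod L = w mod L"
  proof -
    have "z = 1 \<longleftrightarrow> (real_of_int (int v - int w) / real_of_int (int L)) \<in> \<int>"
      by (simp add: z_def e_eq_1_iff)
    also have "\<dots> \<longleftrightarrow> int L dvd int v - int w"
      using assms by (subst of_int_div_of_int_in_Ints_iff) auto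
    also have "\<dots> \<longleftrightarrow> v mod L = w mod L"
      by (metis mod_eq_dvd_iff of_nat_eq_iff of_nat_mod)
    finally show ?thesis .
  qed
  moreover have "(\<Sum>k<L. z ^ k) = 0" if "z \<noteq> 1"
  proof -
    have "z ^ L = e (real_of_int (int v - int w))"
      using assms by (simp add: z_def flip: e_of_nat_mult)
    also have "\<dots> = 1"
      unfolding e_eq_1_iff by (rule Ints_of_int)
    finally show ?thesis
      using that by (simp add: geometric_sum)
  qed
  ultimately show ?thesis
    by auto
qed

text \<open>Expanding the square and summing over \<open>k\<close> first leaves only the diagonal,
  because distinct frequencies in \<open>A\<close> are incongruent modulo \<open>L\<close>.\<close>

lemma parseval_mod:
  fixes L :: nat and B :: "nat \<Rightarrow> complex"
  assumes "L > 0" "finite A" "inj_on (\<lambda>v. v mod L) A"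
  shows "(\<Sum>k<L. (cmod (\<Sum>v\<in>A. B v * e (real v * real k / real L)))\<^sup>2) = real L * (\<Sum>v\<in>A. (cmod (B v))\<^sup>2)"
proof -
  let ?E = "\<lambda>v k. e (real v * real k / real L)"
  \<comment> \<open>The identity is proved in the complex numbers, where a squared modulus is
    \<open>z * cnj z\<close>.\<close>
  have "complex_of_real (\<Sum>k<L. (cmod (\<Sum>v\<in>A. B v * ?E v k))\<^sup>2) =
      (\<Sum>k<L. \<Sum>v\<in>A. \<Sum>w\<in>A. B v * cnj (B w) * (?E v k * cnj (?E w k)))"
    by (simp add: complex_norm_square sum_product mult_ac del: of_real_power)
  also have "\<dots> = (\<Sum>v\<in>A. \<Sum>w\<in>A. \<Sum>k<L. B v * cnj (B w) * (?E v k * cnj (?E w k)))"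
    by (subst sum.swap, rule sum.cong[OF refl], rule sum.swap)
  also have "\<dots> = (\<Sum>v\<in>A. \<Sum>w\<in>A. if v = w then B v * cnj (B w) * of_nat L else 0)"
    unfolding sum_distrib_left[symmetric] e_orthogonality[OF assms(1)]
    using assms(3) by (intro sum.cong refl) (auto simp: inj_on_def)
  also have "\<dots> = complex_of_real (real L * (\<Sum>v\<in>A. (cmod (B v))\<^sup>2))"
    using assms(2) by (simp add: complex_norm_square sum_distrib_left mult_ac del: of_real_power)
  finally show ?thesis
    by (simp only: of_real_eq_iff)
qed

section \<open>The sum over \<open>c\<close> for a single modulus\<close>

lemma cmod_sum_squared_le:
  fixes g :: "'i \<Rightarrow> complex"
  shows "(cmod (\<Sum>i\<in>I. g i))\<^sup>2 \<le> real (card I) * (\<Sum>i\<in>I. (cmod (g i))\<^sup>2)"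
proof -
  have "(cmod (\<Sum>i\<in>I. g i))\<^sup>2 \<le> (\<Sum>i\<in>I. cmod (g i))\<^sup>2"
    by (intro power_mono norm_sum) auto
  also have "\<dots> \<le> real (card I) * (\<Sum>i\<in>I. (cmod (g i))\<^sup>2)"
    using Cauchy_Schwarz_ineq_sum[of "\<lambda>_. 1" "\<lambda>i. cmod (g i)" I] by simp
  finally show ?thesis .
qed

text \<open>Blocks are the fibres of \<open>v div q\<close>. Within one the residues modulo
  \<open>q\<close> are distinct, so Parseval applies; Cauchy-Schwarz over the blocks costs their
  number, \<open>m div q + 1\<close>.\<close>

lemma sum_additive_characters_le:
  fixes q m :: nat and B :: "nat \<Rightarrow> complex"
  assumes "q > 0"
  shows "(\<Sum>c<q. (cmod (\<Sum>v\<le>m. B v * e (real v * real c / real q)))\<^sup>2) \<le>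
    (real q + real m) * (\<Sum>v\<le>m. (cmod (B v))\<^sup>2)"
proof -
  let ?t = "m div q"
  let ?A = "\<lambda>i. {v \<in> {..m}. v div q = i}"
  let ?E = "\<lambda>v c. B v * e (real v * real c / real q)"
  have blocks: "(\<Sum>v\<le>m. h v) = (\<Sum>i\<le>?t. \<Sum>v\<in>?A i. h v)" for h :: "nat \<Rightarrow> 'b::comm_monoid_add"
    by (subst sum.group) (auto intro: div_le_mono)
  have inj: "inj_on (\<lambda>v. v mod q) (?A i)" for i
    by (rule inj_onI) (metis (mono_tags, lifting) div_mult_mod_eq mem_Collect_eq)
  have "(\<Sum>c<q. (cmod (\<Sum>v\<le>m. ?E v c))\<^sup>2) \<le>
      (\<Sum>c<q. real (Suc ?t) * (\<Sum>i\<le>?t. (cmod (\<Sum>v\<in>?A i. ?E v c))\<^sup>2))"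
    unfolding blocks
    by (intro sum_mono order.trans[OF cmod_sum_squared_le]) simp
  also have "\<dots> = real (Suc ?t) * (\<Sum>i\<le>?t. \<Sum>c<q. (cmod (\<Sum>v\<in>?A i. ?E v c))\<^sup>2)"
    unfolding sum_distrib_left[symmetric] by (subst sum.swap) simp
  also have "\<dots> = real (Suc ?t) * (\<Sum>i\<le>?t. real q * (\<Sum>v\<in>?A i. (cmod (B v))\<^sup>2))"
    using assms inj by (subst parseval_mod) auto
  also have "\<dots> = real (Suc ?t * q) * (\<Sum>v\<le>m. (cmod (B v))\<^sup>2)"
    unfolding blocks[of "\<lambda>v. (cmod (B v))\<^sup>2"] by (simp only: sum_distrib_left of_nat_mult mult.assoc)
  also have "\<dots> \<le> (real q + real m) * (\<Sum>v\<le>m. (cmod (B v))\<^sup>2)"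
  proof (rule mult_right_mono)
    \<comment> \<open>The last block may be incomplete; counting it as a full one costs the extra
      \<open>q\<close>.\<close>
    have "Suc ?t * q \<le> q + m"
      by simp
    then show "real (Suc ?t * q) \<le> real q + real m"
      by (metis of_nat_add of_nat_le_iff)
  qed (simp add: sum_nonneg)
  finally show ?thesis .
qed

section \<open>The large sieve at well-spaced grid points\<close>

text \<open>The factor 6 keeps every angle between 0 and \<open>pi / 3\<close>, where the cosine is
  at least 1/2, so the real parts cannot cancel.\<close>

lemma cmod_sum_e_ge:
  fixes n J L :: nat
  assumes "6 * n * J \<le> L" "L > 0"
  shows "real J / 2 \<le> cmod (\<Sum>j<J. e (real n * real j / real L))"
proof -
  have "1 / 2 \<le> Re (e (real n * real j / real L))" if "j < J" for j
  proof -
    have "6 * n * j \<le> L"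
      using assms(1) that by (meson le_trans less_imp_le_nat mult_le_mono2)
    then have "6 * real n * real j \<le> real L"
      by (metis of_nat_le_iff of_nat_mult of_nat_numeral)
    then have "2 * pi * (real n * real j / real L) \<le> pi / 3"
      using assms(2) by (simp add: field_simps)
    then have "cos (pi / 3) \<le> cos (2 * pi * (real n * real j / real L))"
      by (intro cos_monotone_0_pi_le) auto
    then show ?thesis
      by (simp add: e_eq_cis cos_60)
  qed
  then have "real J / 2 \<le> Re (\<Sum>j<J. e (real n * real j / real L))"
    using sum_bounded_below[of "{..<J}" "1/2" "\<lambda>j. Re (e (real n * real j / real L))"]
    by simp
  then show ?thesis
    using complex_Re_le_cmod by (rule order.trans)
qed

text \<open>Each point value is a sum of \<open>J\<close> consecutive values of \<open>S\<close>,
  the polynomial with coefficients \<open>b n = a n / g n\<close>. Cauchy-Schwarz costs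
  \<open>J\<close>, Parseval costs \<open>L\<close>, and passing from \<open>b\<close> back to
  \<open>a\<close> gains \<open>4 / J^2\<close>; the product is \<open>4 L / J\<close>.\<close>

lemma large_sieve_grid:
  fixes p :: "'i \<Rightarrow> nat" and a :: "nat \<Rightarrow> complex" and J L N :: nat
  assumes "finite I" "J > 0" "L > 0" "6 * N * J \<le> L" "A \<subseteq> {..N}"
    and upper: "\<And>i. i \<in> I \<Longrightarrow> p i + J \<le> L"
    and spaced: "\<And>i i'. i \<in> I \<Longrightarrow> i' \<in> I \<Longrightarrow> i \<noteq> i' \<Longrightarrow> p i + J \<le> p i' \<or> p i' + J \<le> p i"
  shows "(\<Sum>i\<in>I. (cmod (\<Sum>n\<in>A. a n * e (real n * real (p i) / real L)))\<^sup>2) \<le>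
    4 * (real L / real J) * (\<Sum>n\<in>A. (cmod (a n))\<^sup>2)"
proof -
  define g where "g n = (\<Sum>j<J. e (real n * real j / real L))" for n :: nat
  define b where "b n = a n / g n" for n
  define S where "S k = (\<Sum>n\<in>A. b n * e (real n * real k / real L))" for k :: nat
  have finA: "finite A"
    using assms(5) finite_subset by blast
  have g_ge: "real J / 2 \<le> cmod (g n)" if "n \<in> A" for n
  proof -
    have "6 * n * J \<le> 6 * N * J"
      using assms(5) that by auto
    then show ?thesis
      unfolding g_def using assms(3,4) by (intro cmod_sum_e_ge) linarith+
  qed
  \<comment> \<open>The lower bound for \<open>g n\<close> is positive, so the division defining
    \<open>b n\<close> is never by zero on \<open>A\<close>.\<close>
  have ag: "a n = b n * g n" if "n \<in> A" for n
    using g_ge[OF that] assms(2) by (auto simp: b_def)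
  \<comment> \<open>Shifting \<open>k\<close> by \<open>j\<close> multiplies the \<open>n\<close>-th
    term by \<open>e (n j / L)\<close>; summed over \<open>j\<close> these factors give
    \<open>g n\<close>, which restores \<open>a n\<close>.\<close>
  have window: "(\<Sum>n\<in>A. a n * e (real n * real k / real L)) = (\<Sum>j<J. S (k + j))" for k
  proof -
    have "(\<Sum>n\<in>A. a n * e (real n * real k / real L)) =
        (\<Sum>n\<in>A. \<Sum>j<J. b n * e (real n * real (k + j) / real L))"
      by (intro sum.cong refl)
        (simp add: ag g_def sum_distrib_left sum_distrib_right e_add algebra_simps add_divide_distrib)
    then show ?thesis
      unfolding S_def by (simp only: sum.swap[of _ A])
  qed
  have inj: "inj_on (\<lambda>n. n mod L) A"
  proof (cases "N = 0")
    case True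
    then show ?thesis
      using assms(5) by (auto simp: inj_on_def)
  next
    case False
    have "6 * N * 1 \<le> 6 * N * J"
      using assms(2) by (intro mult_le_mono) auto
    then have "N < L"
      using False assms(4) by linarith
    with assms(5) have "n < L" if "n \<in> A" for n
      using that by fastforce
    then show ?thesis
      by (auto intro!: inj_onI)
  qed
  have "(\<Sum>i\<in>I. (cmod (\<Sum>n\<in>A. a n * e (real n * real (p i) / real L)))\<^sup>2) \<le>
      (\<Sum>i\<in>I. real J * (\<Sum>j<J. (cmod (S (p i + j)))\<^sup>2))"
    unfolding window by (intro sum_mono order.trans[OF cmod_sum_squared_le]) simp
  also have "\<dots> = real J * (\<Sum>(i, j)\<in>I \<times> {..<J}. (cmod (S (p i + j)))\<^sup>2)"
    by (simp add: sum.cartesian_product flip: sum_distrib_left)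
  also have "\<dots> = real J * (\<Sum>k\<in>(\<lambda>(i, j). p i + j) ` (I \<times> {..<J}). (cmod (S k))\<^sup>2)"
  proof -
    \<comment> \<open>Windows of length \<open>J\<close> starting at points at least
      \<open>J\<close> apart are disjoint, so no grid point is counted twice.\<close>
    have "inj_on (\<lambda>(i, j). p i + j) (I \<times> {..<J})"
    proof (rule inj_onI, clarsimp)
      fix i j i' j'
      assume *: "i \<in> I" "i' \<in> I" "j < J" "j' < J" "p i + j = p i' + j'"
      then have "i = i'"
        using spaced[of i i'] by linarith
      with * show "i = i' \<and> j = j'"
        by simp
    qed
    then show ?thesis
      by (subst sum.reindex) (auto simp: case_prod_unfold o_def)
  qed
  also have "\<dots> \<le> real J * (\<Sum>k<L. (cmod (S k))\<^sup>2)"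
    using upper by (intro mult_left_mono sum_mono2) fastforce+
  also have "\<dots> = real J * real L * (\<Sum>n\<in>A. (cmod (b n))\<^sup>2)"
    unfolding S_def using assms(3) finA inj by (simp add: parseval_mod)
  also have "\<dots> \<le> real J * real L * (\<Sum>n\<in>A. 4 / (real J)\<^sup>2 * (cmod (a n))\<^sup>2)"
  proof (intro mult_left_mono sum_mono)
    fix n assume n: "n \<in> A"
    have "(cmod (b n) * (real J / 2))\<^sup>2 \<le> (cmod (a n))\<^sup>2"
      unfolding ag[OF n] norm_mult using g_ge[OF n] by (intro power_mono mult_left_mono) auto
    then show "(cmod (b n))\<^sup>2 \<le> 4 / (real J)\<^sup>2 * (cmod (a n))\<^sup>2"
      using assms(2) by (simp add: field_simps)
  qed simp
  also have "\<dots> = 4 * (real L / real J) * (\<Sum>n\<in>A. (cmod (a n))\<^sup>2)"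
    unfolding sum_distrib_left[symmetric] using assms(2) by (simp add: power2_eq_square)
  finally show ?thesis .
qed

section \<open>The large sieve for fractions with prime denominators\<close>

text \<open>Since \<open>q\<close> is prime and \<open>0 < d < q\<close>, it must divide
  \<open>q'\<close>; the two primes then agree, and cancelling gives \<open>d = d'\<close>.\<close>

lemma prime_fractions_distinct:
  fixes q d q' d' :: nat
  assumes "prime q" "prime q'" "0 < d" "d < q" "0 < d'" "d' < q'" "d * q' = d' * q"
  shows "q = q' \<and> d = d'"
proof -
  have "q dvd d * q'"
    by (simp add: assms(7))
  moreover have "\<not> q dvd d"
    using assms(3,4) by (simp add: nat_dvd_not_less)
  ultimately have "q dvd q'"
    using assms(1) prime_dvd_mult_iff by blast
  then have "q = q'"
    using assms(1,2) by (simp add: primes_dvd_imp_eq)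
  then show ?thesis
    using assms by auto
qed

lemma large_sieve_prime_moduli:
  fixes R N :: nat and a :: "nat \<Rightarrow> complex"
  assumes "R > 0" "A \<subseteq> {..N}" "\<And>q. q \<in> P \<Longrightarrow> prime q \<and> q \<le> R"
  shows "(\<Sum>q\<in>P. \<Sum>d\<in>{1..<q}. (cmod (\<Sum>n\<in>A. a n * e (real n * real d / real q)))\<^sup>2) \<le>
    4 * real (R\<^sup>2 + 6 * N) * (\<Sum>n\<in>A. (cmod (a n))\<^sup>2)"
proof -
  \<comment> \<open>Only the ratio \<open>L / J = H\<close> enters the bound. Its part
    \<open>R^2\<close> provides the spacing and its part \<open>6 N\<close> the condition against
    cancellation. Taking \<open>J = R!\<close> makes every \<open>q\<close> in \<open>P\<close>
    divide \<open>L\<close>, so \<open>d / q\<close> is the grid point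
    \<open>p (q, d) / L\<close>.\<close>
  define H where "H = R\<^sup>2 + 6 * N"
  define J where "J = (fact R :: nat)"
  define L where "L = H * J"
  define I where "I = (SIGMA q:P. {1..<q})"
  define p where "p = (\<lambda>(q, d). d * (L div q))"
  have J: "J > 0" and L: "L > 0"
    using assms(1) by (simp_all add: J_def L_def H_def)
  have finP: "finite P"
    using assms(3) by (intro finite_subset[of P "{..R}"]) auto
  have qp: "q * p (q, d) = d * L" if "q \<in> P" for q d
  proof -
    have "q dvd L"
      using assms(3)[OF that] prime_gt_0_nat[of q] unfolding L_def J_def
      by (intro dvd_mult dvd_fact) auto
    then show ?thesis
      by (simp add: p_def)
  qed
  have RL: "R * R * J \<le> L"
    by (simp add: L_def H_def power2_eq_square)
  have "(\<Sum>q\<in>P. \<Sum>d\<in>{1..<q}. (cmod (\<Sum>n\<in>A. a n * e (real n * real d / real q)))\<^sup>2) =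
      (\<Sum>i\<in>I. (cmod (\<Sum>n\<in>A. a n * e (real n * real (p i) / real L)))\<^sup>2)"
  proof -
    have frac: "real n * real (p (q, d)) / real L = real n * real d / real q" if "q \<in> P" for n q d
    proof -
      have "real q * real (p (q, d)) = real d * real L"
        by (metis qp[OF that] of_nat_mult)
      moreover have "q > 0"
        using assms(3)[OF that] prime_gt_0_nat by blast
      ultimately show ?thesis
        using L by (simp add: field_simps)
    qed
    show ?thesis
      unfolding I_def using finP by (subst sum.Sigma) (auto simp: frac intro!: sum.cong)
  qed
  also have "\<dots> \<le> 4 * (real L / real J) * (\<Sum>n\<in>A. (cmod (a n))\<^sup>2)"
  proof (rule large_sieve_grid[OF _ J L _ assms(2)])
    show "finite I"
      unfolding I_def using finP by auto
    show "6 * N * J \<le> L"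
      by (simp add: L_def H_def)
    \<comment> \<open>As \<open>d < q\<close>, the fraction \<open>d / q\<close> is at least
      \<open>1 / q\<close> below 1, and \<open>L / q\<close> is at least \<open>J\<close>; the
      window does not run past \<open>L\<close>.\<close>
    show "p i + J \<le> L" if "i \<in> I" for i
    proof -
      obtain q d where i: "i = (q, d)" "q \<in> P" "d < q"
        using \<open>i \<in> I\<close> by (auto simp: I_def)
      have "q * J \<le> R * R * J"
        using assms(1) assms(3)[OF i(2)]
        by (intro mult_le_mono1) (metis le_square le_trans)
      then have "q * J \<le> L"
        using RL by (rule le_trans)
      then have "q * (p i + J) \<le> Suc d * L"
        using qp[OF i(2), of d] by (simp add: i(1) distrib_left)
      also have "\<dots> \<le> q * L"
        using i(3) by (intro mult_le_mono1) simp
      finally show ?thesis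
        using i(3) by simp
    qed
    \<comment> \<open>Distinct fractions \<open>d / q < d' / q'\<close> differ by at least
      \<open>1 / (q q')\<close>, hence by at least \<open>1 / R^2\<close>, which is at least
      \<open>J\<close> grid steps. The argument is multiplied through by \<open>q * q'\<close> to
      stay in the naturals.\<close>
    have step: "p (q, d) + J \<le> p (q', d')"
      if "q \<in> P" "q' \<in> P" "d * q' < d' * q" for q d q' d'
    proof -
      have "q * q' \<le> R * R"
        using assms(3) that by (intro mult_le_mono) auto
      then have "q * q' * J \<le> L"
        using RL by (meson le_trans mult_le_mono1)
      then have "q * q' * (p (q, d) + J) \<le> Suc (d * q') * L"
        using qp[OF that(1), of d] by (simp add: algebra_simps)
      also have "\<dots> \<le> d' * q * L"
        using that(3) by (intro mult_le_mono1) simp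
      also have "\<dots> = q * q' * p (q', d')"
        using qp[OF that(2), of d'] by (simp add: algebra_simps)
      finally show ?thesis
        using assms(3) that prime_gt_0_nat by (metis mult_le_cancel1 nat_0_less_mult_iff)
    qed
    show "p i + J \<le> p i' \<or> p i' + J \<le> p i" if "i \<in> I" "i' \<in> I" "i \<noteq> i'" for i i'
    proof -
      obtain q d q' d' where i: "i = (q, d)" "q \<in> P" "0 < d" "d < q"
        and i': "i' = (q', d')" "q' \<in> P" "0 < d'" "d' < q'"
        using \<open>i \<in> I\<close> \<open>i' \<in> I\<close> by (auto simp: I_def Suc_le_eq)
      then have "d * q' \<noteq> d' * q"
        using prime_fractions_distinct[of q q' d d'] assms(3) that(3) by auto
      then show ?thesis
        using step[of q q' d d'] step[of q' q d' d] i i' by (metis linorder_neqE_nat)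
    qed
  qed
  also have "real L / real J = real H"
    using J by (simp add: L_def)
  finally show ?thesis
    by (simp only: H_def)
qed

section \<open>Combining the two inequalities\<close>

text \<open>Grouping \<open>n\<close> by the value \<open>v = f n\<close> turns the inner sum into a
  polynomial in \<open>c\<close> with coefficients \<open>?S q d v\<close>. The bound over
  \<open>c\<close> separates the values \<open>v\<close>, and the large sieve is then applied to
  each fibre of \<open>f\<close>.\<close>

lemma double_large_sieve:
  fixes R N m :: nat and f :: "nat \<Rightarrow> nat" and a :: "nat \<Rightarrow> complex"
  assumes "R > 0" "A \<subseteq> {..N}" "\<And>q. q \<in> P \<Longrightarrow> prime q \<and> q \<le> R" "\<And>n. n \<in> A \<Longrightarrow> f n \<le> m"
  shows "(\<Sum>q\<in>P. \<Sum>c\<in>{1..<q}. \<Sum>d\<in>{1..<q}.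
      (cmod (\<Sum>n\<in>A. a n * e ((real n * real d + real (f n) * real c) / real q)))\<^sup>2) \<le>
    (real R + real m) * (4 * real (R\<^sup>2 + 6 * N)) * (\<Sum>n\<in>A. (cmod (a n))\<^sup>2)"
proof -
  let ?F = "\<lambda>v. {n \<in> A. f n = v}"
  let ?S = "\<lambda>q d v. \<Sum>n\<in>?F v. a n * e (real n * real d / real q)"
  have finA: "finite A"
    using assms(2) finite_subset by blast
  have fibres: "(\<Sum>n\<in>A. h n) = (\<Sum>v\<le>m. \<Sum>n\<in>?F v. h n)" for h :: "nat \<Rightarrow> 'b::comm_monoid_add"
    using finA assms(4) by (subst sum.group) auto
  have "(\<Sum>q\<in>P. \<Sum>c\<in>{1..<q}. \<Sum>d\<in>{1..<q}.
      (cmod (\<Sum>n\<in>A. a n * e ((real n * real d + real (f n) * real c) / real q)))\<^sup>2) \<le>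
    (\<Sum>q\<in>P. \<Sum>d\<in>{1..<q}. (real R + real m) * (\<Sum>v\<le>m. (cmod (?S q d v))\<^sup>2))"
  proof (rule sum_mono)
    fix q assume q: "q \<in> P"
    have "(\<Sum>c\<in>{1..<q}. (cmod (\<Sum>n\<in>A. a n * e ((real n * real d + real (f n) * real c) / real q)))\<^sup>2)
        \<le> (real R + real m) * (\<Sum>v\<le>m. (cmod (?S q d v))\<^sup>2)" for d
    proof -
      have "(\<Sum>n\<in>A. a n * e ((real n * real d + real (f n) * real c) / real q)) =
          (\<Sum>v\<le>m. ?S q d v * e (real v * real c / real q))" for c
        unfolding fibres sum_distrib_right
        by (intro sum.cong refl) (auto simp: e_add add_divide_distrib)
      then have "(\<Sum>c\<in>{1..<q}. (cmod (\<Sum>n\<in>A. a n * e ((real n * real d + real (f n) * real c) / real q)))\<^sup>2)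
          = (\<Sum>c\<in>{1..<q}. (cmod (\<Sum>v\<le>m. ?S q d v * e (real v * real c / real q)))\<^sup>2)"
        by simp
      \<comment> \<open>The nonnegative term \<open>c = 0\<close> is added to complete the residue
        system.\<close>
      also have "\<dots> \<le> (\<Sum>c<q. (cmod (\<Sum>v\<le>m. ?S q d v * e (real v * real c / real q)))\<^sup>2)"
        by (intro sum_mono2) auto
      also have "\<dots> \<le> (real q + real m) * (\<Sum>v\<le>m. (cmod (?S q d v))\<^sup>2)"
        using assms(3)[OF q] prime_gt_0_nat by (intro sum_additive_characters_le) blast
      also have "\<dots> \<le> (real R + real m) * (\<Sum>v\<le>m. (cmod (?S q d v))\<^sup>2)"
        using assms(3)[OF q] by (intro mult_right_mono sum_nonneg) auto
      finally show ?thesis .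
    qed
    then show "(\<Sum>c\<in>{1..<q}. \<Sum>d\<in>{1..<q}.
        (cmod (\<Sum>n\<in>A. a n * e ((real n * real d + real (f n) * real c) / real q)))\<^sup>2) \<le>
      (\<Sum>d\<in>{1..<q}. (real R + real m) * (\<Sum>v\<le>m. (cmod (?S q d v))\<^sup>2))"
      by (subst sum.swap) (rule sum_mono)
  qed
  also have "\<dots> = (real R + real m) * (\<Sum>v\<le>m. \<Sum>q\<in>P. \<Sum>d\<in>{1..<q}. (cmod (?S q d v))\<^sup>2)"
    unfolding sum_distrib_left[symmetric] by (simp only: sum.swap[of _ _ "{..m}"])
  \<comment> \<open>The fibres partition \<open>A\<close>, so their large sieve bounds add up
    without loss.\<close>
  also have "\<dots> \<le> (real R + real m) *
      (\<Sum>v\<le>m. 4 * real (R\<^sup>2 + 6 * N) * (\<Sum>n\<in>?F v. (cmod (a n))\<^sup>2))"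
    using assms(1,2,3) by (intro mult_left_mono sum_mono large_sieve_prime_moduli) auto
  also have "\<dots> = (real R + real m) * (4 * real (R\<^sup>2 + 6 * N)) * (\<Sum>n\<in>A. (cmod (a n))\<^sup>2)"
    unfolding fibres[of "\<lambda>n. (cmod (a n))\<^sup>2"] by (simp only: sum_distrib_left mult.assoc)
  finally show ?thesis .
qed

theorem theorem2:
  fixes C \<theta> :: real
  assumes "C > 0" and "\<theta> > 0"
  shows "\<exists>K::real. K > 0 \<and>
    (\<forall>(x::real) (Q::real) (f :: nat \<Rightarrow> int) (a :: nat \<Rightarrow> complex).
      x \<ge> 1 \<longrightarrow> Q \<ge> 1 \<longrightarrow>
      (\<forall>n::nat. n > 0 \<and> real n \<le> x \<longrightarrow>
         1 \<le> f n \<and> real_of_int (f n) \<le> C * x powr \<theta>) \<longrightarrow>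
      (\<Sum>q\<in>{q::nat. prime q \<and> odd q \<and> real q \<le> Q}.
         \<Sum>c\<in>{1..<q}. \<Sum>d\<in>{1..<q}.
           (cmod (\<Sum>n\<in>{n::nat. n > 0 \<and> real n \<le> x}.
              a n * e ((real n * real d + real_of_int (f n) * real c) / real q)))\<^sup>2)
      \<le> K * (Q + x powr \<theta>) * (Q\<^sup>2 + x) *
           (\<Sum>n\<in>{n::nat. n > 0 \<and> real n \<le> x}. (cmod (a n))\<^sup>2))"
\<comment> \<open>The factor \<open>1 + C\<close> comes from
  \<open>Q + C x^\<theta> \<le> (1 + C) (Q + x^\<theta>)\<close>, and 24 is the 4 of the large sieve
  times the 6 in front of \<open>N\<close>.\<close>
proof (intro exI[of _ "24 * (1 + C)"] conjI allI impI)
  show "24 * (1 + C) > 0"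
    using assms(1) by simp
next
  fix x Q :: real and f :: "nat \<Rightarrow> int" and a :: "nat \<Rightarrow> complex"
  assume x: "x \<ge> 1" and Q: "Q \<ge> 1"
    and f: "\<forall>n::nat. n > 0 \<and> real n \<le> x \<longrightarrow> 1 \<le> f n \<and> real_of_int (f n) \<le> C * x powr \<theta>"
  define A where "A = {n::nat. n > 0 \<and> real n \<le> x}"
  define P where "P = {q::nat. prime q \<and> odd q \<and> real q \<le> Q}"
  \<comment> \<open>Rounding down loses nothing, since \<open>q\<close>, \<open>n\<close> and
    \<open>f n\<close> are integers; \<open>f n \<ge> 1\<close> allows the passage from integer to
    natural values.\<close>
  define R where "R = nat \<lfloor>Q\<rfloor>"
  define N where "N = nat \<lfloor>x\<rfloor>"
  define m where "m = nat \<lfloor>C * x powr \<theta>\<rfloor>"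
  have M: "0 \<le> C * x powr \<theta>"
    using assms(1) by simp
  have fA: "0 \<le> f n" "nat (f n) \<le> m" if "n \<in> A" for n
  proof -
    have "1 \<le> f n" "real_of_int (f n) \<le> C * x powr \<theta>"
      using f that by (auto simp: A_def)
    then show "0 \<le> f n" "nat (f n) \<le> m"
      by (simp_all add: m_def le_floor_iff nat_mono)
  qed
  have "(\<Sum>q\<in>P. \<Sum>c\<in>{1..<q}. \<Sum>d\<in>{1..<q}.
      (cmod (\<Sum>n\<in>A. a n * e ((real n * real d + real_of_int (f n) * real c) / real q)))\<^sup>2) =
    (\<Sum>q\<in>P. \<Sum>c\<in>{1..<q}. \<Sum>d\<in>{1..<q}.
      (cmod (\<Sum>n\<in>A. a n * e ((real n * real d + real (nat (f n)) * real c) / real q)))\<^sup>2)"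
    using fA(1) by (intro sum.cong refl arg_cong[where f = "\<lambda>z. (cmod z)\<^sup>2"]) simp
  also have "\<dots> \<le> (real R + real m) * (4 * real (R\<^sup>2 + 6 * N)) * (\<Sum>n\<in>A. (cmod (a n))\<^sup>2)"
  proof (rule double_large_sieve)
    show "R > 0"
      using Q by (simp add: R_def)
    show "A \<subseteq> {..N}"
      by (auto simp: A_def N_def le_nat_floor)
    show "prime q \<and> q \<le> R" if "q \<in> P" for q
      using that by (simp add: P_def R_def le_nat_floor)
  qed (rule fA(2))
  also have "\<dots> \<le> 24 * (1 + C) * (Q + x powr \<theta>) * (Q\<^sup>2 + x) * (\<Sum>n\<in>A. (cmod (a n))\<^sup>2)"
  proof (rule mult_right_mono)
    have R: "real R \<le> Q" and N: "real N \<le> x" and m: "real m \<le> C * x powr \<theta>"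
      using x Q M by (auto simp: R_def N_def m_def)
    have "0 \<le> C * Q"
      using assms(1) Q by simp
    then have 1: "real R + real m \<le> (1 + C) * (Q + x powr \<theta>)"
      using R m powr_ge_zero[of x \<theta>] unfolding distrib_left distrib_right by linarith
    have "4 * (real R)\<^sup>2 \<le> 24 * Q\<^sup>2"
      using R by (intro mult_mono power_mono) auto
    then have 2: "4 * real (R\<^sup>2 + 6 * N) \<le> 24 * (Q\<^sup>2 + x)"
      using N by (simp add: distrib_left)
    have "(real R + real m) * (4 * real (R\<^sup>2 + 6 * N)) \<le>
        ((1 + C) * (Q + x powr \<theta>)) * (24 * (Q\<^sup>2 + x))"
      using assms(1) Q by (intro mult_mono[OF 1 2]) simp_all
    then show "(real R + real m) * (4 * real (R\<^sup>2 + 6 * N)) \<le>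
        24 * (1 + C) * (Q + x powr \<theta>) * (Q\<^sup>2 + x)"
      by (simp only: mult_ac)
  qed (simp add: sum_nonneg)
  finally show "(\<Sum>q\<in>{q::nat. prime q \<and> odd q \<and> real q \<le> Q}.
         \<Sum>c\<in>{1..<q}. \<Sum>d\<in>{1..<q}.
           (cmod (\<Sum>n\<in>{n::nat. n > 0 \<and> real n \<le> x}.
              a n * e ((real n * real d + real_of_int (f n) * real c) / real q)))\<^sup>2)
      \<le> 24 * (1 + C) * (Q + x powr \<theta>) * (Q\<^sup>2 + x) *
           (\<Sum>n\<in>{n::nat. n > 0 \<and> real n \<le> x}. (cmod (a n))\<^sup>2)"
    unfolding A_def P_def .
qed

end
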